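(* Let $p>1$, $T>0$ and $x\in C([0,T];\mathbb{R})$. Then $x$ is $p$-rough if and only if $$x\in V_p(\mathbb T),\qquad [x]^p_{\mathbb T}(T)>0,\qquad \lim_{L\to\infty}\mathfrak R_{p,L}(x)=0. \qquad ( * )$$ When these conditions hold, $[x]^p=[x]^p_{\mathbb T}$, and for every integer $L\ge 2$, $$\lim_{\delta\downarrow 0}\Omega_p^{[x]^p_{\mathbb T}}(x;\delta)\ \le\ \mathfrak R_{p,L}(x)\ \le\ 2\,\Omega_p^{[x]^p}(x;T/L).$$ Consequently, the class of $p$-rough paths is unchanged if the dyadic multiresolution in condition $( * )$ is replaced by any fixed $q$-adic partition sequence ($q\ge2$ an integer), i.e. if in the definitions of $\mathbb T_m$, $h_m$, $\mathbb T_m^{b,r}$, $\mathcal C^p_m$ and $\mathfrak R_{p,L}$ the number $2^m$ is replaced by $q^m$.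
   Context: Stopped $p$-energy: for a finite partition $\lambda=\{0=u_0<\dots<u_N=T\}$ and $t\in[0,T]$, $\mathsf V^p_\lambda(x;t):=\sum_{i=0}^{N-1}|x(u_{i+1}\wedge t)-x(u_i\wedge t)|^p$. Shifted uniform grids: for $0<\ell\le T$, $0\le a<\ell$, $\Pi(\ell,a):=\{0,T\}\cup\{a+k\ell: k\in\mathbb Z,\ 0<a+k\ell<T\}$. For a continuous nondecreasing $A:[0,T]\to[0,\infty)$ with $A(0)=0$ and $0<\delta\le T$, $\Omega^A_p(x;\delta):=\sup_{0<\ell\le\delta}\sup_{0\le a<\ell}\sup_{t\in[0,T]}|\mathsf V^p_{\Pi(\ell,a)}(x;t)-A(t)|$. $p$-roughness: $x\in C([0,T];\mathbb R)$ is $p$-rough if $\Omega_p^A(x;\delta)\to0$ as $\delta\downarrow0$ for some continuous nondecreasing $A:[0,T]\to[0,\infty)$ with $A(T)>A(0)=0$. Such an $A$ is unique and is denoted $[x]^p$ (intrinsic $p$-th variation). Finite $p$-th variation along a sequence: for a sequence $\lambda=(\lambda_n)$ of partitions $\lambda_n=\{0=u^n_0<\dots<u^n_{N(\lambda_n)}=T\}$ with mesh tending to $0$, $x\in V_p(\lambda)$ means that the measures $\sum_i|x(u^n_{i+1})-x(u^n_i)|^p\delta_{u^n_i}$ converge weakly to a finite nonatomic Borel measure $\mu^{p,x}_\lambda$ on $[0,T]$; then $[x]^p_\lambda(t):=\mu_\lambda^{p,x}([0,t])$. Dyadic multiresolution: $h_m:=T2^{-m}$, $\mathbb T_m:=\{jh_m:0\le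 j\le 2^m\}$, $\mathbb T=(\mathbb T_m)_m$. For integers $1\le b\le 2^m$, $0\le r<b$, $\mathbb T_m^{b,r}:=\{0,T\}\cup\{jh_m:1\le j<2^m,\ j\equiv r \pmod b\}$, and $\mathcal C_m^p(x;b,r;t):=\mathsf V^p_{\mathbb T_m^{b,r}}(x;t)-\mathsf V^p_{\mathbb T_m}(x;t)$. For integers $L\ge2$, $$\mathfrak R_{p,L}(x):=\limsup_{m\to\infty}\ \sup_{L\le b\le\lfloor 2^m/L\rfloor,\ 0\le r<b}\ \sup_{t\in[0,T]}|\mathcal C^p_m(x;b,r;t)|\in[0,\infty].$$ *)

theory Defs
  imports "HOL-Analysis.Analysis"
begin

text \<open>A path on \<open>[0,T]\<close> is a total function \<open>real \<Rightarrow> real\<close> of which only the values on \<open>{0..T}\<close>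
  are ever used. A partition is the finite set of its points.\<close>

definition is_partition :: "real \<Rightarrow> real set \<Rightarrow> bool" where
  "is_partition T P \<longleftrightarrow> finite P \<and> {0, T} \<subseteq> P \<and> P \<subseteq> {0..T}"

definition pt :: "real set \<Rightarrow> nat \<Rightarrow> real" where
  "pt P i = sorted_list_of_set P ! i"

definition intervals :: "real set \<Rightarrow> nat" where
  "intervals P = card P - 1"

definition mesh :: "real set \<Rightarrow> real" where
  "mesh P = Max ((\<lambda>i. pt P (i + 1) - pt P i) ` {..<intervals P})"

definition penergy :: "real \<Rightarrow> (real \<Rightarrow> real) \<Rightarrow> real set \<Rightarrow> real \<Rightarrow> real" where
  "penergy p x P t =
     (\<Sum>i<intervals P. \<bar>x (min (pt P (i + 1)) t) - x (min (pt P i) t)\<bar> powr p)"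

definition shifted_grid :: "real \<Rightarrow> real \<Rightarrow> real \<Rightarrow> real set" where
  "shifted_grid T l a =
     {0, T} \<union> {a + of_int k * l | k :: int. 0 < a + of_int k * l \<and> a + of_int k * l < T}"

definition Omega :: "real \<Rightarrow> real \<Rightarrow> (real \<Rightarrow> real) \<Rightarrow> (real \<Rightarrow> real) \<Rightarrow> real \<Rightarrow> ennreal" where
  "Omega T p A x \<delta> =
     (SUP l\<in>{0<..\<delta>}. SUP a\<in>{0..<l}. SUP t\<in>{0..T}.
        ennreal \<bar>penergy p x (shifted_grid T l a) t - A t\<bar>)"

definition intrinsic_variation_of ::
    "real \<Rightarrow> real \<Rightarrow> (real \<Rightarrow> real) \<Rightarrow> (real \<Rightarrow> real) \<Rightarrow> bool" where
  "intrinsic_variation_of T p x A \<longleftrightarrow>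
     continuous_on {0..T} A \<and> mono_on {0..T} A \<and> A 0 = 0 \<and> A T > 0 \<and>
     (Omega T p A x \<longlongrightarrow> 0) (at_right 0)"

definition p_rough :: "real \<Rightarrow> real \<Rightarrow> (real \<Rightarrow> real) \<Rightarrow> bool" where
  "p_rough T p x \<longleftrightarrow> (\<exists>A. intrinsic_variation_of T p x A)"

text \<open>The function chosen here is unique on \<open>{0..T}\<close>; its values elsewhere are irrelevant.\<close>

definition intrinsic_variation :: "real \<Rightarrow> real \<Rightarrow> (real \<Rightarrow> real) \<Rightarrow> real \<Rightarrow> real" where
  "intrinsic_variation T p x = (SOME A. intrinsic_variation_of T p x A)"

text \<open>The discrete measure \<open>\<Sum>i. \<bar>x (u (i+1)) - x (u i)\<bar>^p \<delta>_(u i)\<close> on \<open>[0,T]\<close>, as the image under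
  \<open>i \<mapsto> u i\<close> of a weighted counting measure on the indices.\<close>

definition energy_measure :: "real \<Rightarrow> real \<Rightarrow> (real \<Rightarrow> real) \<Rightarrow> real set \<Rightarrow> real measure" where
  "energy_measure T p x P =
     distr (point_measure {..<intervals P} (\<lambda>i. ennreal (\<bar>x (pt P (i + 1)) - x (pt P i)\<bar> powr p)))
       (restrict_space borel {0..T}) (pt P)"

text \<open>Weak convergence of finite measures on the compact space \<open>[0,T]\<close>, where continuous test
  functions are automatically bounded. The library's \<open>weak_conv_m\<close> is stated through distribution
  functions and geared to probability measures on the whole line.\<close>

definition converges_weakly_on :: "real \<Rightarrow> (nat \<Rightarrow> real measure) \<Rightarrow> real measure \<Rightarrow> bool" where
  "converges_weakly_on T M \<mu> \<longleftrightarrow>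
     (\<forall>f :: real \<Rightarrow> real. continuous_on {0..T} f \<longrightarrow>
        (\<lambda>n. integral\<^sup>L (M n) f) \<longlonglongrightarrow> integral\<^sup>L \<mu> f)"

definition nonatomic :: "'a measure \<Rightarrow> bool" where
  "nonatomic \<mu> \<longleftrightarrow>
     \<not> (\<exists>A\<in>sets \<mu>. emeasure \<mu> A > 0 \<and>
          (\<forall>B\<in>sets \<mu>. B \<subseteq> A \<longrightarrow> emeasure \<mu> B = 0 \<or> emeasure \<mu> B = emeasure \<mu> A))"

definition variation_measure_of ::
    "real \<Rightarrow> real \<Rightarrow> (nat \<Rightarrow> real set) \<Rightarrow> (real \<Rightarrow> real) \<Rightarrow> real measure \<Rightarrow> bool" where
  "variation_measure_of T p \<Lambda> x \<mu> \<longleftrightarrow>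
     sets \<mu> = sets (restrict_space borel {0..T}) \<and> finite_measure \<mu> \<and> nonatomic \<mu> \<and>
     converges_weakly_on T (\<lambda>n. energy_measure T p x (\<Lambda> n)) \<mu>"

definition has_variation_along ::
    "real \<Rightarrow> real \<Rightarrow> (nat \<Rightarrow> real set) \<Rightarrow> (real \<Rightarrow> real) \<Rightarrow> bool" where
  "has_variation_along T p \<Lambda> x \<longleftrightarrow>
     (\<forall>n. is_partition T (\<Lambda> n)) \<and> (\<lambda>n. mesh (\<Lambda> n)) \<longlonglongrightarrow> 0 \<and>
     (\<exists>\<mu>. variation_measure_of T p \<Lambda> x \<mu>)"

text \<open>Weak limits are unique, so the choice is immaterial.\<close>

definition variation_measure ::
    "real \<Rightarrow> real \<Rightarrow> (nat \<Rightarrow> real set) \<Rightarrow> (real \<Rightarrow> real) \<Rightarrow> real measure" where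
  "variation_measure T p \<Lambda> x = (SOME \<mu>. variation_measure_of T p \<Lambda> x \<mu>)"

definition variation_along ::
    "real \<Rightarrow> real \<Rightarrow> (nat \<Rightarrow> real set) \<Rightarrow> (real \<Rightarrow> real) \<Rightarrow> real \<Rightarrow> real" where
  "variation_along T p \<Lambda> x t = measure (variation_measure T p \<Lambda> x) {0..t}"

definition adic_grid :: "real \<Rightarrow> nat \<Rightarrow> nat \<Rightarrow> real set" where
  "adic_grid T q m = {real j * (T / real q ^ m) | j :: nat. j \<le> q ^ m}"

definition adic_subgrid :: "real \<Rightarrow> nat \<Rightarrow> nat \<Rightarrow> nat \<Rightarrow> nat \<Rightarrow> real set" where
  "adic_subgrid T q m b r =
     {0, T} \<union> {real j * (T / real q ^ m) | j :: nat. 1 \<le> j \<and> j < q ^ m \<and> j mod b = r mod b}"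

definition adic_defect ::
    "real \<Rightarrow> nat \<Rightarrow> real \<Rightarrow> (real \<Rightarrow> real) \<Rightarrow> nat \<Rightarrow> nat \<Rightarrow> nat \<Rightarrow> real \<Rightarrow> real" where
  "adic_defect T q p x m b r t =
     penergy p x (adic_subgrid T q m b r) t - penergy p x (adic_grid T q m) t"

text \<open>For the finitely many \<open>m\<close> with \<open>q ^ m div L < L\<close> the supremum is over the empty set, hence
  \<open>0\<close>; this does not affect the limit superior.\<close>

definition defect_limsup :: "real \<Rightarrow> nat \<Rightarrow> real \<Rightarrow> nat \<Rightarrow> (real \<Rightarrow> real) \<Rightarrow> ennreal" where
  "defect_limsup T q p L x =
     limsup (\<lambda>m. SUP b\<in>{L..q ^ m div L}. SUP r\<in>{..<b}. SUP t\<in>{0..T}.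
       ennreal \<bar>adic_defect T q p x m b r t\<bar>)"

definition adic_criterion :: "real \<Rightarrow> nat \<Rightarrow> real \<Rightarrow> (real \<Rightarrow> real) \<Rightarrow> bool" where
  "adic_criterion T q p x \<longleftrightarrow>
     has_variation_along T p (adic_grid T q) x \<and>
     variation_along T p (adic_grid T q) x T > 0 \<and>
     (\<lambda>L. defect_limsup T q p L x) \<longlonglongrightarrow> 0"

end

theory Submission
  imports Defs "HOL-Probability.Distribution_Functions"
begin

text \<open>An adic subgrid is a shifted grid with \<open>l = b h\<close> and \<open>a = r h\<close>, where \<open>h = T / q ^ m\<close>. Comparing two such
  grids with \<open>A\<close> gives the upper bound \<open>2 \<Omega> (T / L)\<close>. Conversely every pair \<open>(l, a)\<close> is a limit of
  such pairs, and the energy along a shifted grid is continuous in \<open>(l, a)\<close>, so \<open>\<Omega> (T / L)\<close> is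
  at most the limsup of the defects as soon as the energies along the adic grids themselves converge
  pointwise to \<open>A\<close>. That pointwise convergence is equivalent to weak convergence of the energy
  measures to the nonatomic measure with distribution function \<open>A\<close>; it also identifies
  \<open>A\<close>, so that the two uses of \<open>SOME\<close> in the definitions agree.\<close>

subsection \<open>Energies along shifted and adic grids\<close>

lemma sorted_list_of_set_insert_greater:
  assumes "finite P" "\<And>s. s \<in> P \<Longrightarrow> s < z"
  shows "sorted_list_of_set (insert z P) = sorted_list_of_set P @ [z]"
proof -
  have "sorted_wrt (<) (sorted_list_of_set P @ [z])"
    using assms by (auto simp: sorted_wrt_append)
  then show ?thesis
    using assms by (subst sorted_list_of_set_unique[symmetric]) (auto simp: card_insert_if)
qed

text \<open>A new rightmost point is appended to the sorted list and leaves all earlier indices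
  unchanged, so the energy gains exactly one summand. This is the induction step for computing
  energies along explicit enumerations.\<close>

lemma penergy_insert_greater:
  assumes "finite P" "w \<in> P" "\<And>s. s \<in> P \<Longrightarrow> s \<le> w" "w < z"
  shows "penergy p x (insert z P) t = penergy p x P t + \<bar>x (min z t) - x (min w t)\<bar> powr p"
proof -
  let ?s = "sorted_list_of_set P"
  have eq: "sorted_list_of_set (insert z P) = ?s @ [z]"
    using assms by (intro sorted_list_of_set_insert_greater) force+
  have z: "z \<notin> P" using assms by force
  have len: "length ?s = card P" by simp
  have pos: "card P > 0" using assms by (auto simp: card_gt_0_iff)
  \<comment> \<open>Removing \<open>w\<close> and appending it again identifies it as the last entry
    of the sorted list.\<close>
  have "sorted_list_of_set (insert w (P - {w})) = sorted_list_of_set (P - {w}) @ [w]"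
    using assms by (intro sorted_list_of_set_insert_greater) force+
  then have w: "?s ! (card P - 1) = w"
    using assms(1,2) by (simp add: insert_absorb nth_append)
  have old: "pt (insert z P) i = pt P i" if "i < card P" for i
    using that len by (simp add: pt_def eq nth_append)
  have new: "pt (insert z P) (card P) = z"
    using len by (simp add: pt_def eq nth_append)
  have "intervals (insert z P) = Suc (intervals P)"
    using assms(1) z pos by (simp add: intervals_def)
  moreover have "pt (insert z P) (intervals P) = w"
    using old[of "intervals P"] w pos by (simp add: intervals_def pt_def)
  moreover have "pt (insert z P) (Suc (intervals P)) = z" using new pos by (simp add: intervals_def)
  moreover have "(\<Sum>i<intervals P. \<bar>x (min (pt (insert z P) (i + 1)) t) - x (min (pt (insert z P) i) t)\<bar> powr p)
      = penergy p x P t"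
    unfolding penergy_def using old pos by (intro sum.cong) (auto simp: intervals_def)
  ultimately show ?thesis
    by (simp add: penergy_def[of p x "insert z P"])
qed

text \<open>The enumeration may repeat points: a repetition leaves the set unchanged and adds the
  summand \<open>0 powr p\<close>, which is 0. Hence the energy can be computed without knowing how
  many distinct points there are.\<close>

lemma penergy_mono_image:
  fixes u :: "nat \<Rightarrow> real"
  assumes "mono u"
  shows "penergy p x (u ` {..N}) t = (\<Sum>i<N. \<bar>x (min (u (i + 1)) t) - x (min (u i) t)\<bar> powr p)"
proof (induction N)
  case 0
  then show ?case by (simp add: penergy_def intervals_def)
next
  case (Suc N)
  show ?case
  proof (cases "u (Suc N) = u N")
    case True
    then have "u ` {..Suc N} = u ` {..N}" by (auto simp: atMost_Suc)
    with Suc True show ?thesis by simp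
  next
    case False
    then have "u N < u (Suc N)" using assms by (simp add: mono_def order.not_eq_order_implies_strict)
    then show ?thesis using Suc assms penergy_insert_greater[of "u ` {..N}" "u N" "u (Suc N)" p x t]
      by (auto simp: atMost_Suc mono_def)
  qed
qed

text \<open>Clamping sends the points outside \<open>[0,T]\<close> to the endpoints, where they contribute nothing to
  the energy. The energy thus becomes a sum whose length is locally constant in \<open>(l, a)\<close>.\<close>

definition clamped_grid :: "real \<Rightarrow> real \<Rightarrow> real \<Rightarrow> nat \<Rightarrow> real" where
  "clamped_grid T l a i = max 0 (min T (a + (real i - 1) * l))"

text \<open>Index \<open>i\<close> stands for the integer \<open>k = i - 1\<close>. Index 0 gives a
  - l < 0, which is clamped to 0, and the bound on \<open>K\<close> makes index \<open>K\<close>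
  clamp to \<open>T\<close>, so both endpoints are attained.\<close>

lemma shifted_grid_eq_image:
  assumes "0 < T" "0 \<le> a" "a < l" "T \<le> a + (real K - 1) * l"
  shows "shifted_grid T l a = clamped_grid T l a ` {..K}"
proof (intro equalityI subsetI)
  fix s assume "s \<in> shifted_grid T l a"
  then consider "s = 0" | "s = T" | k :: int where "s = a + of_int k * l" "0 < s" "s < T"
    by (auto simp: shifted_grid_def)
  then show "s \<in> clamped_grid T l a ` {..K}"
  proof cases
    case 1
    then show ?thesis using assms by (intro image_eqI[of _ _ 0]) (auto simp: clamped_grid_def)
  next
    case 2
    then show ?thesis using assms by (intro image_eqI[of _ _ K]) (auto simp: clamped_grid_def)
  next
    case (3 k)
    \<comment> \<open>Positivity of the point together with a < l forces k > -1, so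
      \<open>k + 1\<close> is an admissible index.\<close>
    have "- l < of_int k * l" using 3 assms by linarith
    then have "0 < (of_int k + 1) * l" by (simp add: algebra_simps)
    then have "0 < (of_int k + 1 :: real)" using assms by (simp add: zero_less_mult_iff)
    then have k: "k \<ge> 0" by linarith
    have "of_int k * l < (real K - 1) * l" using 3 assms by linarith
    then have "of_int k < real K - 1" using assms by simp
    then have "k + 1 < int K" by linarith
    then show ?thesis using 3 k
      by (intro image_eqI[of _ _ "nat (k + 1)"]) (auto simp: clamped_grid_def)
  qed
next
  fix s assume "s \<in> clamped_grid T l a ` {..K}"
  then obtain i where "s = max 0 (min T (a + (real i - 1) * l))" by (auto simp: clamped_grid_def)
  then consider "s = 0" | "s = T" | "s = a + of_int (int i - 1) * l" "0 < s" "s < T"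
    by (fastforce simp: max_def min_def split: if_splits)
  then show "s \<in> shifted_grid T l a"
    by cases (auto simp only: shifted_grid_def)
qed

lemma mono_clamped_grid: "0 < l \<Longrightarrow> mono (clamped_grid T l a)"
  unfolding mono_def clamped_grid_def
  by (intro allI impI max.mono min.mono add_mono mult_right_mono order.refl) auto

lemma penergy_shifted_grid:
  assumes "0 < T" "0 \<le> a" "a < l" "T \<le> a + (real K - 1) * l"
  shows "penergy p x (shifted_grid T l a) t =
    (\<Sum>i<K. \<bar>x (min (clamped_grid T l a (i + 1)) t) - x (min (clamped_grid T l a i) t)\<bar> powr p)"
  using shifted_grid_eq_image[OF assms] penergy_mono_image[OF mono_clamped_grid] assms by auto

text \<open>With \<open>K\<close> chosen so that T < a + K l holds strictly, the same number of
  summands serves all nearby parameters. Each summand is then continuous in the parameters, even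
  when grid points enter or leave (0,T).\<close>

lemma tendsto_penergy_shifted_grid:
  fixes ls as :: "nat \<Rightarrow> real"
  assumes T: "0 < T" and p: "0 < p" and x: "continuous_on {0..T} x" and t: "t \<in> {0..T}"
    and a: "0 \<le> a" "a < l" and ls: "ls \<longlonglongrightarrow> l" and as: "as \<longlonglongrightarrow> a" and as0: "\<And>n. 0 \<le> as n"
  shows "(\<lambda>n. penergy p x (shifted_grid T (ls n) (as n)) t) \<longlonglongrightarrow> penergy p x (shifted_grid T l a) t"
proof -
  obtain K where "T / l < real K" using reals_Archimedean2 by blast
  then have K: "T < a + (real (K + 1) - 1) * l" using a by (auto simp: field_simps)
  let ?V = "\<lambda>l a. \<Sum>i<K + 1. \<bar>x (min (clamped_grid T l a (i + 1)) t) - x (min (clamped_grid T l a i) t)\<bar> powr p"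
  have pts: "(\<lambda>n. x (min (clamped_grid T (ls n) (as n) i) t)) \<longlonglongrightarrow> x (min (clamped_grid T l a i) t)" for i
  proof (rule continuous_on_tendsto_compose[OF x])
    show "(\<lambda>n. min (clamped_grid T (ls n) (as n) i) t) \<longlonglongrightarrow> min (clamped_grid T l a i) t"
      unfolding clamped_grid_def by (intro tendsto_intros ls as)
  qed (use T t in \<open>auto simp: clamped_grid_def min_le_iff_disj\<close>)
  have "(\<lambda>n. ?V (ls n) (as n)) \<longlonglongrightarrow> ?V l a"
    using p by (intro tendsto_sum tendsto_powr' tendsto_rabs tendsto_diff pts tendsto_const) auto
  moreover have "\<forall>\<^sub>F n in sequentially. as n < ls n"
    using order_tendstoD(2)[OF tendsto_diff[OF as ls], of 0] a by simp
  then have "\<forall>\<^sub>F n in sequentially. ?V (ls n) (as n) = penergy p x (shifted_grid T (ls n) (as n)) t"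
    using order_tendstoD(1)[OF tendsto_add[OF as tendsto_mult[OF tendsto_const ls]] K]
  proof eventually_elim
    case (elim n)
    then show ?case using T as0[of n] by (subst penergy_shifted_grid[where K = "K + 1"]) auto
  qed
  ultimately have "(\<lambda>n. penergy p x (shifted_grid T (ls n) (as n)) t) \<longlonglongrightarrow> ?V l a"
    by (rule Lim_transform_eventually)
  then show ?thesis using T a K by (subst penergy_shifted_grid[where K = "K + 1"]) auto
qed

section \<open>Adic grids as shifted uniform grids\<close>

lemma adic_subgrid_eq_shifted_grid:
  fixes m :: nat
  assumes "0 < T" "0 < q" "r < b"
  defines "h \<equiv> T / real q ^ m"
  shows "adic_subgrid T q m b r = shifted_grid T (real b * h) (real r * h)"
proof -
  have h: "0 < h" using assms by simp
  have T: "T = real (q ^ m) * h" using assms by (simp add: h_def)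
  have "{real j * h | j :: nat. 1 \<le> j \<and> j < q ^ m \<and> j mod b = r mod b} =
      {real r * h + of_int k * (real b * h) | k :: int.
        0 < real r * h + of_int k * (real b * h) \<and> real r * h + of_int k * (real b * h) < T}"
    (is "?A = ?B")
  proof (intro equalityI subsetI)
    fix s assume "s \<in> ?A"
    then obtain j :: nat where j: "s = real j * h" "1 \<le> j" "j < q ^ m" "j mod b = r mod b" by blast
    \<comment> \<open>Euclidean division turns the congruence condition into the integer parameter
      \<open>k = j div b\<close>.\<close>
    have "int j = int r + int (j div b) * int b" using j(4) assms
      by (metis div_mult_mod_eq add.commute mod_less of_nat_add of_nat_mult)
    then have "real j = real r + of_int (int (j div b)) * real b"
      by (metis of_int_add of_int_mult of_int_of_nat_eq)
    then have "s = real r * h + of_int (int (j div b)) * (real b * h)"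
      using j(1) by (metis (no_types) distrib_right mult.assoc)
    moreover have "0 < s" "s < T" using j h T by simp_all
    ultimately show "s \<in> ?B" by blast
  next
    fix s assume "s \<in> ?B"
    then obtain k :: int where k: "s = real r * h + of_int k * (real b * h)" "0 < s" "s < T" by blast
    define j where "j = int r + k * int b"
    have s: "s = of_int j * h" using k by (simp add: j_def algebra_simps)
    then have "0 < j" using k h by (simp add: zero_less_mult_iff)
    moreover have "j < int (q ^ m)" using s k(3) T h
      by (metis mult_less_cancel_right_pos of_int_less_iff of_int_of_nat_eq)
    moreover have "nat j mod b = r mod b"
      using \<open>0 < j\<close> by (metis j_def mod_mult_self1 nat_int of_nat_mod zmod_int nat_mod_distrib
          of_nat_0_le_iff less_imp_le)
    moreover have "s = real (nat j) * h" using s \<open>0 < j\<close> by simp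
    ultimately show "s \<in> ?A" by (intro CollectI exI[of _ "nat j"]) (auto simp: nat_less_iff)
  qed
  then show ?thesis by (simp add: adic_subgrid_def shifted_grid_def h_def)
qed

lemma adic_grid_eq_adic_subgrid:
  assumes "0 < T" "0 < q"
  shows "adic_grid T q m = adic_subgrid T q m 1 0"
proof -
  have "real (q ^ m) * (T / real q ^ m) = T" using assms by simp
  then have "T \<in> adic_grid T q m" unfolding adic_grid_def by (metis (mono_tags, lifting) CollectI le_refl)
  moreover have "0 \<in> adic_grid T q m" unfolding adic_grid_def by force
  moreover have "real j * (T / real q ^ m) \<in> adic_subgrid T q m 1 0" if j: "j \<le> q ^ m" for j
  proof -
    consider "j = 0" | "j = q ^ m" | "1 \<le> j" "j < q ^ m"
      using j by linarith
    then show ?thesis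
      using \<open>real (q ^ m) * (T / real q ^ m) = T\<close> by cases (auto simp: adic_subgrid_def)
  qed
  ultimately show ?thesis by (fastforce simp: adic_grid_def adic_subgrid_def)
qed

lemma adic_grid_eq_shifted_grid:
  assumes "0 < T" "0 < q"
  shows "adic_grid T q m = shifted_grid T (T / real q ^ m) 0"
  using adic_grid_eq_adic_subgrid[OF assms] adic_subgrid_eq_shifted_grid[OF assms, of 0 1] by simp

section \<open>Two-sided comparison of \<open>Omega\<close> with the adic defects\<close>

lemma penergy_shifted_grid_le_Omega:
  assumes "0 < l" "l \<le> \<delta>" "0 \<le> a" "a < l" "t \<in> {0..T}"
  shows "ennreal \<bar>penergy p x (shifted_grid T l a) t - A t\<bar> \<le> Omega T p A x \<delta>"
  unfolding Omega_def using assms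
  by (intro SUP_upper2[where i = l] SUP_upper2[where i = a] SUP_upper2[where i = t]) auto

lemma Omega_mono: "\<delta> \<le> \<epsilon> \<Longrightarrow> Omega T p A x \<delta> \<le> Omega T p A x \<epsilon>"
  unfolding Omega_def by (intro SUP_subset_mono) auto

lemma tendsto_adic_width:
  assumes "2 \<le> q"
  shows "(\<lambda>m. T / real q ^ m) \<longlonglongrightarrow> 0"
  using assms by (intro tendsto_divide_0[OF tendsto_const] filterlim_at_top_imp_at_infinity
      filterlim_realpow_sequentially_gt1) auto

text \<open>The full adic grid is the shifted grid of width T / q^m and shift 0, so its deviation
  from \<open>A\<close> is at most \<open>Omega\<close> at that width, and the widths tend to 0 from
  the right.\<close>

lemma tendsto_penergy_adic_grid:
  assumes T: "0 < T" and q: "2 \<le> q" and t: "t \<in> {0..T}" and "(Omega T p A x \<longlongrightarrow> 0) (at_right 0)"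
  shows "(\<lambda>m. penergy p x (adic_grid T q m) t) \<longlonglongrightarrow> A t"
proof -
  let ?h = "\<lambda>m. T / real q ^ m"
  have h: "0 < ?h m" for m using T q by simp
  have "filterlim ?h (at_right 0) sequentially"
    using tendsto_adic_width[OF q] by (auto intro!: tendsto_imp_filterlim_at_right always_eventually h simp del: zero_less_divide_iff)
  then have *: "(\<lambda>m. Omega T p A x (?h m)) \<longlonglongrightarrow> 0"
    using assms(4) filterlim_compose by blast
  have "(\<lambda>m. ennreal \<bar>penergy p x (adic_grid T q m) t - A t\<bar>) \<longlonglongrightarrow> 0"
  proof (rule tendsto_sandwich[OF _ _ tendsto_const *])
    show "\<forall>\<^sub>F m in sequentially. ennreal \<bar>penergy p x (adic_grid T q m) t - A t\<bar> \<le> Omega T p A x (?h m)"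
      using T q h t adic_grid_eq_shifted_grid
      by (intro always_eventually allI) (auto intro!: penergy_shifted_grid_le_Omega)
  qed simp
  then show ?thesis
    by (simp add: tendsto_ennreal_iff[of _ _ 0, simplified] tendsto_rabs_zero_iff LIM_zero_iff)
qed

text \<open>Triangle inequality through \<open>A t\<close>. The range of \<open>b\<close> keeps both
  widths, that of the subgrid and that of the full grid, at most T / L. The bound holds at every
  level \<open>m\<close>, hence for the limsup.\<close>

lemma defect_limsup_le_Omega:
  assumes T: "0 < T" and q: "2 \<le> q" and L: "1 \<le> L"
  shows "defect_limsup T q p L x \<le> 2 * Omega T p A x (T / real L)"
proof -
  let ?\<Omega> = "Omega T p A x (T / real L)"
  have "ennreal \<bar>adic_defect T q p x m b r t\<bar> \<le> 2 * ?\<Omega>"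
    if b: "b \<in> {L..q ^ m div L}" and r: "r < b" and t: "t \<in> {0..T}" for m b r t
  proof -
    let ?h = "T / real q ^ m"
    let ?V = "penergy p x (shifted_grid T (real b * ?h) (real r * ?h)) t"
    let ?W = "penergy p x (shifted_grid T ?h 0) t"
    have h: "0 < ?h" using T q by simp
    \<comment> \<open>The upper limit \<open>q ^ m div L\<close> for \<open>b\<close> is exactly the
      condition that the width b h is at most T / L.\<close>
    have "b * L \<le> q ^ m" using b L by (metis atLeastAtMost_iff less_eq_div_iff_mult_less_eq zero_less_one order_less_le_trans)
    then have "real b * real L \<le> real q ^ m" by (metis of_nat_le_iff of_nat_mult of_nat_power)
    then have "real b * ?h * real L \<le> real q ^ m * ?h" using h
      by (metis mult.assoc mult.commute mult_right_mono less_imp_le)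
    then have bL: "real b * ?h \<le> T / real L" using q L by (simp add: pos_le_divide_eq)
    have "1 * ?h \<le> real b * ?h" using b L less_imp_le[OF h] by (intro mult_right_mono) auto
    with bL have hL: "?h \<le> T / real L" by linarith
    have *: "adic_defect T q p x m b r t = ?V - ?W"
      using T q r by (simp add: adic_defect_def adic_subgrid_eq_shifted_grid adic_grid_eq_shifted_grid)
    have "ennreal \<bar>?V - A t\<bar> \<le> ?\<Omega>"
      using less_imp_le[OF h] h r bL t
      by (intro penergy_shifted_grid_le_Omega mult_strict_right_mono mult_nonneg_nonneg mult_pos_pos) auto
    moreover have "ennreal \<bar>?W - A t\<bar> \<le> ?\<Omega>"
      using h hL t by (intro penergy_shifted_grid_le_Omega) auto
    ultimately have "ennreal \<bar>?V - A t\<bar> + ennreal \<bar>?W - A t\<bar> \<le> 2 * ?\<Omega>"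
      unfolding mult_2 by (rule add_mono)
    moreover have "ennreal \<bar>?V - ?W\<bar> \<le> ennreal \<bar>?V - A t\<bar> + ennreal \<bar>?W - A t\<bar>"
      unfolding ennreal_plus[OF abs_ge_zero abs_ge_zero, symmetric] by (intro ennreal_leI) linarith
    ultimately show ?thesis unfolding * by (rule order_trans[rotated])
  qed
  then show ?thesis unfolding defect_limsup_def
    by (intro Limsup_bounded always_eventually allI SUP_least) auto
qed

lemma tendsto_floor_mult:
  fixes h :: "nat \<Rightarrow> real"
  assumes "0 \<le> c" "\<And>m. 0 < h m" "h \<longlonglongrightarrow> 0"
  shows "(\<lambda>m. real (nat \<lfloor>c / h m\<rfloor>) * h m) \<longlonglongrightarrow> c"
proof -
  have *: "real (nat \<lfloor>c / h m\<rfloor>) * h m \<le> c" "c - h m \<le> real (nat \<lfloor>c / h m\<rfloor>) * h m" for m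
  proof -
    have "real (nat \<lfloor>c / h m\<rfloor>) \<le> c / h m" "c / h m - 1 \<le> real (nat \<lfloor>c / h m\<rfloor>)"
      using assms(1) assms(2)[of m] by (simp, linarith)
    then show "real (nat \<lfloor>c / h m\<rfloor>) * h m \<le> c" "c - h m \<le> real (nat \<lfloor>c / h m\<rfloor>) * h m"
      using assms(2)[of m] by (auto simp: field_simps)
  qed
  show ?thesis
    by (rule tendsto_sandwich[of "\<lambda>m. c - h m" _ _ "\<lambda>m. c"])
       (use * tendsto_diff[OF tendsto_const assms(3), of c] in auto)
qed

text \<open>Every shifted grid of width at most \<open>T / L\<close> is a limit of adic subgrids with
  \<open>L \<le> b \<le> q ^ m div L\<close>; their energies converge because \<open>x\<close> is continuous.\<close>

lemma Omega_le_defect_limsup: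
  assumes T: "0 < T" and p: "0 < p" and q: "2 \<le> q" and x: "continuous_on {0..T} x" and L: "1 \<le> L"
    and A: "\<And>t. t \<in> {0..T} \<Longrightarrow> (\<lambda>m. penergy p x (adic_grid T q m) t) \<longlonglongrightarrow> A t"
  shows "Omega T p A x (T / real L) \<le> defect_limsup T q p L x"
  unfolding Omega_def
proof (intro SUP_least)
  fix l a t assume l: "l \<in> {0<..T / real L}" and a: "a \<in> {0..<l}" and t: "t \<in> {0..T}"
  let ?h = "\<lambda>m. T / real q ^ m"
  \<comment> \<open>Rounding \<open>l\<close> and \<open>a\<close> down to multiples of the mesh
    gives admissible parameters: rounding down never pushes the width above T / L, and a < l yields
    r < b for large \<open>m\<close>.\<close>
  define b r where "b m = nat \<lfloor>l / ?h m\<rfloor>" and "r m = nat \<lfloor>a / ?h m\<rfloor>" for m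
  let ?V = "\<lambda>m. penergy p x (shifted_grid T (real (b m) * ?h m) (real (r m) * ?h m)) t"
  have h: "0 < ?h m" for m using T q by simp
  have h0: "?h \<longlonglongrightarrow> 0" by (rule tendsto_adic_width[OF q])
  have bl: "(\<lambda>m. real (b m) * ?h m) \<longlonglongrightarrow> l" and ra: "(\<lambda>m. real (r m) * ?h m) \<longlonglongrightarrow> a"
    unfolding b_def r_def by (rule tendsto_floor_mult[OF _ h h0], use l a in simp)+
  have "\<forall>\<^sub>F m in sequentially. real (r m) * ?h m < real (b m) * ?h m"
    using order_tendstoD(2)[OF tendsto_diff[OF ra bl], of 0] a by simp
  then have rb: "\<forall>\<^sub>F m in sequentially. r m < b m"
    by eventually_elim (use h in \<open>metis mult_less_cancel_right_pos of_nat_less_iff\<close>)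
  \<comment> \<open>For fixed \<open>L\<close> the length L h tends to 0 while b h tends to l > 0,
    so the lower bound on \<open>b\<close> holds eventually.\<close>
  have "(\<lambda>m. real L * ?h m) \<longlonglongrightarrow> real L * 0" by (intro tendsto_intros h0)
  then have "\<forall>\<^sub>F m in sequentially. real L * ?h m < real (b m) * ?h m"
    using order_tendstoD(2)[OF tendsto_diff[OF _ bl], of "\<lambda>m. real L * ?h m" 0 0] l
    by (simp del: times_divide_eq_right)
  then have Lb: "\<forall>\<^sub>F m in sequentially. L \<le> b m"
    by eventually_elim (use h in \<open>metis mult_less_cancel_right_pos of_nat_less_iff less_imp_le\<close>)
  have bL: "b m \<le> q ^ m div L" for m
  proof -
    have "real (b m) \<le> l / ?h m" using l h[of m] unfolding b_def by (intro of_nat_floor divide_nonneg_pos) auto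
    also have "\<dots> \<le> (T / real L) / ?h m" using l h[of m] by (intro divide_right_mono) auto
    also have "\<dots> = real (q ^ m) / real L" using T by simp
    finally have "real (b m) * real L \<le> real (q ^ m)" using L by (simp add: pos_le_divide_eq)
    then have "b m * L \<le> q ^ m" by (metis of_nat_le_iff of_nat_mult)
    then show ?thesis using L by (simp add: less_eq_div_iff_mult_less_eq)
  qed
  have "?V \<longlonglongrightarrow> penergy p x (shifted_grid T l a) t"
    using a by (intro tendsto_penergy_shifted_grid T p x t bl ra mult_nonneg_nonneg less_imp_le[OF h]) auto
  then have "(\<lambda>m. ennreal \<bar>?V m - penergy p x (adic_grid T q m) t\<bar>) \<longlonglongrightarrow>
      ennreal \<bar>penergy p x (shifted_grid T l a) t - A t\<bar>"
    by (intro tendsto_ennrealI tendsto_rabs tendsto_diff A t)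
  \<comment> \<open>The deviation is a limit of individual defects. Read as a limsup, it can be
    compared termwise with the suprema in \<open>defect_limsup\<close>.\<close>
  then have "ennreal \<bar>penergy p x (shifted_grid T l a) t - A t\<bar> =
      limsup (\<lambda>m. ennreal \<bar>?V m - penergy p x (adic_grid T q m) t\<bar>)"
    by (rule lim_imp_Limsup[OF trivial_limit_sequentially, symmetric])
  also have "\<dots> \<le> defect_limsup T q p L x"
    unfolding defect_limsup_def
  proof (rule Limsup_mono, use rb Lb in eventually_elim)
    case (elim m)
    have *: "?V m - penergy p x (adic_grid T q m) t = adic_defect T q p x m (b m) (r m) t"
      unfolding adic_defect_def using T q elim by (subst adic_subgrid_eq_shifted_grid) auto
    have b: "b m \<in> {L..q ^ m div L}" and r: "r m \<in> {..<b m}" using elim bL[of m] by auto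
    show ?case unfolding *
      by (rule SUP_upper2[OF b], rule SUP_upper2[OF r], rule SUP_upper2[OF t], rule order_refl)
  qed
  finally show "ennreal \<bar>penergy p x (shifted_grid T l a) t - A t\<bar> \<le> defect_limsup T q p L x" .
qed

subsection \<open>Weak convergence on a compact interval\<close>

text \<open>Intersecting with the space makes the half-line measurable for a measure living on [0,T]
  only, and lets \<open>t\<close> range over all reals. The result is the cdf of the image measure
  on the line.\<close>

definition interval_mass :: "real measure \<Rightarrow> real \<Rightarrow> real" where
  "interval_mass M t = measure M ({..t} \<inter> space M)"

locale finite_measure_on_Icc = finite_measure M for M :: "real measure" and T :: real +
  assumes sets_eq: "sets M = sets (restrict_space borel {0..T})"
begin

lemma space_eq: "space M = {0..T}"
  using sets_eq_imp_space_eq[OF sets_eq] by (simp add: space_restrict_space)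

lemma measurable_id_borel [measurable]: "(\<lambda>s. s) \<in> borel_measurable M"
  using borel_measurable_continuous_on_restrict[OF continuous_on_id, of "{0..T}"]
  by (simp add: measurable_cong_sets[OF sets_eq refl])

lemma continuous_on_imp_measurable:
  fixes f :: "real \<Rightarrow> real"
  assumes "continuous_on {0..T} f"
  shows "f \<in> borel_measurable M"
  using borel_measurable_continuous_on_restrict[OF assms] by (simp add: measurable_cong_sets[OF sets_eq refl])

lemma continuous_on_imp_integrable:
  fixes f :: "real \<Rightarrow> real"
  assumes "continuous_on {0..T} f"
  shows "integrable M f"
proof -
  have "bounded (f ` {0..T})"
    using assms by (intro compact_imp_bounded compact_continuous_image) auto
  then obtain B where "\<And>s. s \<in> {0..T} \<Longrightarrow> norm (f s) \<le> B" unfolding bounded_iff by blast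
  then show ?thesis
    using continuous_on_imp_measurable[OF assms]
    by (intro integrable_const_bound[of _ B]) (auto simp: space_eq)
qed

lemma finite_borel_measure_distr: "finite_borel_measure (distr M borel (\<lambda>s. s))"
  unfolding finite_borel_measure_def finite_borel_measure_axioms_def
  by (simp add: finite_measure_distr)

lemma interval_mass_eq_cdf: "interval_mass M = cdf (distr M borel (\<lambda>s. s))"
  by (auto simp: interval_mass_def cdf_def measure_distr)

lemma interval_mass_eq_measure: "t \<le> T \<Longrightarrow> interval_mass M t = measure M {0..t}"
  by (auto simp: interval_mass_def space_eq intro!: arg_cong[of _ _ "measure M"])

lemma mono_interval_mass: "mono (interval_mass M)"
  using finite_borel_measure.cdf_nondecreasing[OF finite_borel_measure_distr]
  by (simp add: interval_mass_eq_cdf mono_def)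

text \<open>The cdf of the image measure can be discontinuous at \<open>t\<close> only if
  \<open>t\<close> carries mass.\<close>

lemma isCont_interval_mass:
  assumes "\<And>s. measure M {s} = 0"
  shows "isCont (interval_mass M) t"
proof -
  have "measure M ({t} \<inter> space M) = 0" using assms by (cases "t \<in> space M") auto
  then show ?thesis
    using finite_borel_measure.isCont_cdf[OF finite_borel_measure_distr]
    by (simp add: interval_mass_eq_cdf measure_distr)
qed

lemma singleton_in_sets: "s \<in> {0..T} \<Longrightarrow> {s} \<in> sets M"
  unfolding sets_eq by (auto simp: sets_restrict_space image_iff intro!: bexI[of _ "{s}"])

text \<open>A singleton has only two subsets, so a singleton of positive mass would be an atom.
  Points outside [0,T] are not in the sigma-algebra and get the default measure 0.\<close>

lemma nonatomic_imp_singleton_null: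
  assumes "nonatomic M"
  shows "measure M {s} = 0"
proof (cases "s \<in> {0..T}")
  case True
  have "\<forall>B\<in>sets M. B \<subseteq> {s} \<longrightarrow> emeasure M B = 0 \<or> emeasure M B = emeasure M {s}"
    by (metis emeasure_empty subset_singletonD)
  then have "emeasure M {s} = 0"
    using assms singleton_in_sets[OF True] unfolding nonatomic_def by (meson zero_less_iff_neq_zero)
  then show ?thesis by (simp add: measure_def)
next
  case False
  then show ?thesis using sets.sets_into_space by (metis measure_notin_sets insert_subset space_eq)
qed

text \<open>An intermediate-value argument for \<open>t \<mapsto> M (A \<inter> [0,t])\<close> halves any set of positive measure.\<close>

lemma singletons_null_imp_nonatomic:
  assumes null: "\<And>s. measure M {s} = 0"
  shows "nonatomic M"
proof -
  have "\<exists>B\<in>sets M. B \<subseteq> A \<and> emeasure M B \<noteq> 0 \<and> emeasure M B \<noteq> emeasure M A"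
    if A: "A \<in> sets M" "emeasure M A > 0" for A
  proof -
    have pos: "measure M A > 0" using A by (simp add: emeasure_eq_measure)
    let ?g = "\<lambda>t. measure M ({..t} \<inter> space M \<inter> A)"
    have It: "{..t} \<inter> space M \<in> sets M" for t by measurable
    have ItA: "{..t} \<inter> space M \<inter> A \<in> sets M" for t using It A by blast
    \<comment> \<open>The increments of \<open>?g\<close> are dominated by those of
      \<open>interval_mass\<close>, from which \<open>?g\<close> inherits continuity.\<close>
    have incr: "\<bar>?g s - ?g t\<bar> \<le> \<bar>interval_mass M s - interval_mass M t\<bar>" for s t
    proof -
      have *: "\<bar>?g s - ?g t\<bar> \<le> \<bar>interval_mass M s - interval_mass M t\<bar>" if "s \<le> t" for s t
      proof -
        let ?D = "{..t} \<inter> space M - {..s} \<inter> space M"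
        have "?g t - ?g s = measure M ({..t} \<inter> space M \<inter> A - {..s} \<inter> space M \<inter> A)"
          using that by (intro finite_measure_Diff[symmetric] ItA) auto
        also have "\<dots> \<le> measure M ?D"
          using It by (intro finite_measure_mono) auto
        also have "\<dots> = interval_mass M t - interval_mass M s"
          unfolding interval_mass_def using that by (intro finite_measure_Diff It) auto
        finally have "?g t - ?g s \<le> interval_mass M t - interval_mass M s" .
        moreover have "?g s \<le> ?g t" using that ItA by (intro finite_measure_mono) auto
        ultimately show ?thesis by linarith
      qed
      show ?thesis using *[of s t] *[of t s] by (cases "s \<le> t") (auto simp: abs_minus_commute)
    qed
    have "isCont ?g t" for t
    proof -
      have "((\<lambda>s. interval_mass M s - interval_mass M t) \<longlongrightarrow> 0) (at t)"
        using isCont_interval_mass[OF null, of t] by (simp add: isCont_def LIM_zero_iff)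
      then have "((\<lambda>s. ?g s - ?g t) \<longlongrightarrow> 0) (at t)"
        by (rule Lim_null_comparison[rotated, OF tendsto_rabs_zero]) (auto simp: incr)
      then show ?thesis by (simp add: isCont_def LIM_zero_iff)
    qed
    \<comment> \<open>The endpoints for the intermediate value theorem: -1 lies left of the whole
      space, and \<open>max T 0\<close> lies right of both the space and -1, whatever the sign of
      \<open>T\<close>.\<close>
    moreover have "?g (- 1) = 0" by (simp add: space_eq)
    moreover have "?g (max T 0) = measure M A"
      using sets.sets_into_space[OF A(1)] by (auto simp: space_eq intro!: arg_cong[of _ _ "measure M"])
    ultimately have "\<exists>t\<ge>- 1. t \<le> max T 0 \<and> ?g t = measure M A / 2"
      using pos by (intro IVT') (auto simp: continuous_at_imp_continuous_on)
    then obtain t where t: "?g t = measure M A / 2" by blast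
    show ?thesis
      using t pos ItA by (intro bexI[of _ "{..t} \<inter> space M \<inter> A"]) (auto simp: emeasure_eq_measure)
  qed
  then show ?thesis unfolding nonatomic_def by blast
qed

text \<open>The step function with value \<open>f (k T / n)\<close> on \<open>((k - 1) T / n, k T / n]\<close>, whose integral
  is written by Abel summation in terms of \<open>interval_mass\<close>.\<close>

lemma integral_step_approximation:
  fixes f :: "real \<Rightarrow> real"
  assumes T: "0 < T" and n: "0 < n" and f: "continuous_on {0..T} f"
    and e: "\<And>s s'. s \<in> {0..T} \<Longrightarrow> s' \<in> {0..T} \<Longrightarrow> \<bar>s - s'\<bar> \<le> T / real n \<Longrightarrow> \<bar>f s - f s'\<bar> \<le> e"
  defines "\<tau> \<equiv> \<lambda>k :: nat. real k * (T / real n)"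
  shows "\<bar>integral\<^sup>L M f - (f T * interval_mass M T - (\<Sum>k<n. (f (\<tau> (Suc k)) - f (\<tau> k)) * interval_mass M (\<tau> k)))\<bar>
    \<le> e * interval_mass M T"
proof -
  let ?I = "\<lambda>t. {..t} \<inter> space M"
  define \<phi> where "\<phi> s = f T * indicator (?I T) s - (\<Sum>k<n. (f (\<tau> (Suc k)) - f (\<tau> k)) * indicator (?I (\<tau> k)) s)" for s :: real
  have It: "?I t \<in> sets M" for t by measurable
  have ind: "integrable M (\<lambda>s. c * indicator (?I t) s)" "(\<integral>s. c * indicator (?I t) s \<partial>M) = c * interval_mass M t"
    for c t :: real
    using It by (auto simp: interval_mass_def emeasure_eq_measure)
  have \<phi>_int: "integrable M \<phi>"
    unfolding \<phi>_def by (intro Bochner_Integration.integrable_diff Bochner_Integration.integrable_sum ind)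
  have \<phi>: "integral\<^sup>L M \<phi> = f T * interval_mass M T - (\<Sum>k<n. (f (\<tau> (Suc k)) - f (\<tau> k)) * interval_mass M (\<tau> k))"
    unfolding \<phi>_def
    by (simp only: Bochner_Integration.integral_diff Bochner_Integration.integral_sum
        Bochner_Integration.integrable_sum ind)
  have close: "\<bar>f s - \<phi> s\<bar> \<le> e" if s: "s \<in> space M" for s
  proof -
    define w where "w = T / real n"
    have w: "0 < w" "T = real n * w" using T n by (auto simp: w_def)
    have s': "0 \<le> s" "s \<le> T" using s by (auto simp: space_eq)
    \<comment> \<open>The smallest index with s <= \<open>\<tau> j\<close>. Only the indicators with
      k >= j contribute at \<open>s\<close>, and their coefficients telescope to f T - f
      (\<open>\<tau> j\<close>).\<close>
    define j where "j = nat \<lceil>s / w\<rceil>"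
    have j: "real j - 1 < s / w" "s / w \<le> real j"
    proof -
      have "0 \<le> \<lceil>s / w\<rceil>" using s' w by (simp add: ceiling_le_iff le_ceiling_iff less_le_trans[of _ 0])
      then have "real j = of_int \<lceil>s / w\<rceil>" by (simp add: j_def)
      then show "real j - 1 < s / w" "s / w \<le> real j" by linarith+
    qed
    have "s / w \<le> real n" using s' w by (simp add: pos_divide_le_eq)
    then have jn: "j \<le> n" using j by linarith
    have le_iff: "s \<le> \<tau> k \<longleftrightarrow> j \<le> k" for k
    proof -
      have "s \<le> \<tau> k \<longleftrightarrow> s / w \<le> real k" using w(1) by (simp add: \<tau>_def w_def[symmetric] pos_divide_le_eq)
      also have "\<dots> \<longleftrightarrow> j \<le> k" using j by linarith
      finally show ?thesis .
    qed
    have "(\<Sum>k<n. (f (\<tau> (Suc k)) - f (\<tau> k)) * indicator (?I (\<tau> k)) s) = (\<Sum>k=j..<n. f (\<tau> (Suc k)) - f (\<tau> k))"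
      using s le_iff by (intro sum.mono_neutral_cong_right) (auto simp: indicator_def)
    also have "\<dots> = f (\<tau> n) - f (\<tau> j)" by (rule sum_Suc_diff'[OF jn])
    finally have "\<phi> s = f (\<tau> j)"
      using s s' w by (simp add: \<phi>_def \<tau>_def w_def[symmetric])
    moreover have "\<bar>s - \<tau> j\<bar> \<le> w"
      using j w(1) by (simp add: \<tau>_def w_def[symmetric] field_simps)
    moreover have "\<tau> j \<in> {0..T}"
      using jn w by (auto simp: \<tau>_def w_def[symmetric])
    ultimately show ?thesis using e[of s "\<tau> j"] s' by (simp add: w_def)
  qed
  have "\<bar>integral\<^sup>L M f - integral\<^sup>L M \<phi>\<bar> = \<bar>\<integral>s. f s - \<phi> s \<partial>M\<bar>"
    using \<phi>_int continuous_on_imp_integrable[OF f] by simp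
  also have "\<dots> \<le> (\<integral>s. \<bar>f s - \<phi> s\<bar> \<partial>M)" by (rule integral_abs_bound)
  also have "\<dots> \<le> (\<integral>s. e \<partial>M)"
    using \<phi>_int continuous_on_imp_integrable[OF f] close by (intro integral_mono) auto
  also have "\<dots> = e * interval_mass M T"
    by (simp add: interval_mass_eq_measure space_eq mult.commute)
  finally show ?thesis by (simp add: \<phi>)
qed

end

text \<open>The step approximation of an integral uses finitely many values of
  \<open>interval_mass\<close>, which converge by assumption. Its error is controlled uniformly in
  \<open>n\<close> because the total masses are eventually bounded.\<close>

lemma converges_weakly_on_if_interval_mass:
  assumes T: "0 < T" and M: "finite_measure_on_Icc M T" and Mn: "\<And>n. finite_measure_on_Icc (Mn n) T"
    and lim: "\<And>t. t \<in> {0..T} \<Longrightarrow> (\<lambda>n. interval_mass (Mn n) t) \<longlonglongrightarrow> interval_mass M t"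
  shows "converges_weakly_on T Mn M"
  unfolding converges_weakly_on_def
proof (intro allI impI)
  fix f :: "real \<Rightarrow> real" assume f: "continuous_on {0..T} f"
  \<comment> \<open>An eventual bound for all total masses. With e =
    \<open>\<epsilon> / (3 * C)\<close>, the two step approximations and the convergence of the sums
    each cost at most a third of \<open>\<epsilon>\<close>.\<close>
  define C where "C = interval_mass M T + 1"
  have C: "C > 0" by (simp add: C_def interval_mass_def add_nonneg_pos)
  show "(\<lambda>n. integral\<^sup>L (Mn n) f) \<longlonglongrightarrow> integral\<^sup>L M f"
  proof (rule tendstoI)
    fix \<epsilon> :: real assume \<epsilon>: "0 < \<epsilon>"
    define e where "e = \<epsilon> / (3 * C)"
    have e: "e > 0" "e * C = \<epsilon> / 3" using \<epsilon> C by (auto simp: e_def)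
    have "uniformly_continuous_on {0..T} f" using f by (simp add: compact_uniformly_continuous)
    then obtain d where d: "d > 0"
      "\<And>s s'. s \<in> {0..T} \<Longrightarrow> s' \<in> {0..T} \<Longrightarrow> \<bar>s - s'\<bar> < d \<Longrightarrow> \<bar>f s - f s'\<bar> < e"
      unfolding uniformly_continuous_on_def dist_real_def using e(1) by metis
    obtain N where N: "T / d < real N" using reals_Archimedean2 by blast
    then have N0: "0 < N" using T d by (metis divide_pos_pos less_trans of_nat_0_less_iff)
    have "T / real N < d" using N N0 d by (simp add: field_simps)
    then have osc: "\<bar>f s - f s'\<bar> \<le> e" if "s \<in> {0..T}" "s' \<in> {0..T}" "\<bar>s - s'\<bar> \<le> T / real N" for s s'
      using d(2)[OF that(1,2)] that(3) by linarith
    let ?\<tau> = "\<lambda>k. real k * (T / real N)"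
    define S where "S M = f T * interval_mass M T - (\<Sum>k<N. (f (?\<tau> (Suc k)) - f (?\<tau> k)) * interval_mass M (?\<tau> k))" for M
    have step: "\<bar>integral\<^sup>L M f - S M\<bar> \<le> e * interval_mass M T" if "finite_measure_on_Icc M T" for M
      unfolding S_def by (rule finite_measure_on_Icc.integral_step_approximation[OF that T N0 f osc])
    have "?\<tau> k \<in> {0..T}" if "k < N" for k
    proof -
      have "real k * (T / real N) \<le> real N * (T / real N)" using that T by (intro mult_right_mono) auto
      then show ?thesis using T N0 by simp
    qed
    then have "(\<lambda>n. S (Mn n)) \<longlonglongrightarrow> S M"
      unfolding S_def using T by (intro tendsto_intros lim) auto
    then have "\<forall>\<^sub>F n in sequentially. dist (S (Mn n)) (S M) < \<epsilon> / 3" using \<epsilon> by (intro tendstoD) auto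
    moreover have "\<forall>\<^sub>F n in sequentially. interval_mass (Mn n) T < C"
      using lim[of T] T by (intro order_tendstoD(2)) (auto simp: C_def)
    ultimately show "\<forall>\<^sub>F n in sequentially. dist (integral\<^sup>L (Mn n) f) (integral\<^sup>L M f) < \<epsilon>"
    proof eventually_elim
      case (elim n)
      have "e * interval_mass (Mn n) T \<le> e * C" "e * interval_mass M T < e * C"
        using e elim by (auto simp: C_def)
      then show ?case using step[OF M] step[OF Mn[of n]] elim e unfolding dist_real_def by linarith
    qed
  qed
qed

text \<open>Portmanteau argument: the indicator of {..t} is squeezed between two continuous ramps of
  width \<open>w\<close>, and continuity of the limiting distribution function at \<open>t\<close>
  makes the loss small.\<close>

lemma tendsto_interval_mass_if_converges_weakly_on:
  assumes M: "finite_measure_on_Icc M T" and Mn: "\<And>n. finite_measure_on_Icc (Mn n) T"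
    and weak: "converges_weakly_on T Mn M" and cont: "isCont (interval_mass M) t"
  shows "(\<lambda>n. interval_mass (Mn n) t) \<longlonglongrightarrow> interval_mass M t"
proof (rule tendstoI)
  fix e :: real assume e: "0 < e"
  obtain d where d: "d > 0" "\<And>s. \<bar>s - t\<bar> < d \<Longrightarrow> \<bar>interval_mass M s - interval_mass M t\<bar> < e / 2"
    using cont e unfolding continuous_at_eps_delta dist_real_def by (metis half_gt_zero)
  define w where "w = d / 2"
  have w: "w > 0" using d by (simp add: w_def)
  have near: "\<bar>interval_mass M (t - w) - interval_mass M t\<bar> < e / 2" "\<bar>interval_mass M (t + w) - interval_mass M t\<bar> < e / 2"
    using d by (auto simp: w_def)
  let ?r = "\<lambda>t s. min 1 (max 0 ((t - s) / w))"
  have cont_r: "continuous_on {0..T} (?r t)" for t using w by (intro continuous_intros) auto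
  \<comment> \<open>The ramp is 1 up to t - w and 0 from t on. Taken at \<open>t\<close> it bounds
    \<open>interval_mass\<close> at \<open>t\<close> from below, taken at \<open>t + w\<close> from
    above.\<close>
  have ramp: "interval_mass N (t - w) \<le> integral\<^sup>L N (?r t)" "integral\<^sup>L N (?r t) \<le> interval_mass N t"
    if N: "finite_measure_on_Icc N T" for N t
  proof -
    interpret finite_measure_on_Icc N T by fact
    have ind: "{..t} \<inter> space N \<in> sets N" for t by measurable
    have int: "integrable N (indicat_real ({..t} \<inter> space N))" for t
      using ind by (simp add: emeasure_eq_measure)
    have eq: "interval_mass N t = (\<integral>s. indicator ({..t} \<inter> space N) s \<partial>N)" for t
      using ind by (simp add: interval_mass_def)
    show "interval_mass N (t - w) \<le> integral\<^sup>L N (?r t)"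
      unfolding eq using w by (intro integral_mono int continuous_on_imp_integrable cont_r) (auto simp: indicator_def field_simps)
    show "integral\<^sup>L N (?r t) \<le> interval_mass N t"
      unfolding eq using w by (intro integral_mono int continuous_on_imp_integrable cont_r) (auto simp: indicator_def field_simps)
  qed
  have lim: "(\<lambda>n. integral\<^sup>L (Mn n) (?r t)) \<longlonglongrightarrow> integral\<^sup>L M (?r t)" for t
    using weak cont_r by (simp add: converges_weakly_on_def)
  have "\<forall>\<^sub>F n in sequentially. dist (integral\<^sup>L (Mn n) (?r t)) (integral\<^sup>L M (?r t)) < e / 2"
    "\<forall>\<^sub>F n in sequentially. dist (integral\<^sup>L (Mn n) (?r (t + w))) (integral\<^sup>L M (?r (t + w))) < e / 2"
    using e by (intro tendstoD lim; simp)+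
  then show "\<forall>\<^sub>F n in sequentially. dist (interval_mass (Mn n) t) (interval_mass M t) < e"
  proof eventually_elim
    case (elim n)
    then show ?case
      using near ramp[OF M, of t] ramp[OF M, of "t + w", unfolded add_diff_cancel_right'] ramp[OF Mn, of n t] ramp[OF Mn, of n "t + w", unfolded add_diff_cancel_right']
      unfolding dist_real_def by linarith
  qed
qed

subsection \<open>Energy measures of the adic grids\<close>

lemma pt_mem: "finite P \<Longrightarrow> i < card P \<Longrightarrow> pt P i \<in> P"
  unfolding pt_def by (metis length_sorted_list_of_set nth_mem set_sorted_list_of_set)

text \<open>Atoms sit at left endpoints, so an increment counts in full once its left endpoint is at
  most \<open>t\<close>, whereas \<open>penergy\<close> stops it at \<open>t\<close>.\<close>

lemma
  assumes P: "is_partition T P"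
  shows finite_measure_on_Icc_energy_measure: "finite_measure_on_Icc (energy_measure T p x P) T"
    and interval_mass_energy_measure: "interval_mass (energy_measure T p x P) t =
      (\<Sum>i | i < intervals P \<and> pt P i \<le> t. \<bar>x (pt P (i + 1)) - x (pt P i)\<bar> powr p)"
proof -
  let ?w = "\<lambda>i. \<bar>x (pt P (i + 1)) - x (pt P i)\<bar> powr p"
  let ?M = "point_measure {..<intervals P} (\<lambda>i. ennreal (?w i))"
  have pt: "pt P i \<in> {0..T}" if "i < intervals P" for i
  proof -
    have "finite P" "P \<subseteq> {0..T}" using P by (auto simp: is_partition_def)
    moreover have "i < card P" using that by (simp add: intervals_def)
    ultimately show ?thesis using pt_mem by blast
  qed
  then have meas: "pt P \<in> measurable ?M (restrict_space borel {0..T})"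
    by (auto simp: space_restrict_space)
  have "finite_measure ?M"
    by (intro finite_measureI) (simp add: space_point_measure emeasure_point_measure_finite sum_ennreal)
  then have "finite_measure (energy_measure T p x P)"
    unfolding energy_measure_def by (rule finite_measure.finite_measure_distr[OF _ meas])
  then show fin: "finite_measure_on_Icc (energy_measure T p x P) T"
    unfolding finite_measure_on_Icc_def finite_measure_on_Icc_axioms_def by (simp add: energy_measure_def)
  interpret finite_measure_on_Icc "energy_measure T p x P" T by (rule fin)
  have "{..t} \<inter> space (energy_measure T p x P) \<in> sets (energy_measure T p x P)" by measurable
  then have "{..t} \<inter> {0..T} \<in> sets (restrict_space borel {0..T})"
    unfolding space_eq sets_eq .
  then have "interval_mass (energy_measure T p x P) t =
      measure ?M (pt P -` ({..t} \<inter> {0..T}) \<inter> {..<intervals P})"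
    unfolding interval_mass_def space_eq unfolding energy_measure_def
    using meas by (subst measure_distr) (auto simp: space_point_measure)
  also have "pt P -` ({..t} \<inter> {0..T}) \<inter> {..<intervals P} = {i. i < intervals P \<and> pt P i \<le> t}"
    using pt by auto
  also have "measure ?M \<dots> = (\<Sum>i | i < intervals P \<and> pt P i \<le> t. ?w i)"
    by (subst measure_point_measure_finite_if) auto
  finally show "interval_mass (energy_measure T p x P) t = (\<Sum>i | i < intervals P \<and> pt P i \<le> t. ?w i)" .
qed

lemma sorted_list_of_adic_grid:
  assumes "0 < T" "0 < q"
  shows "sorted_list_of_set (adic_grid T q m) = map (\<lambda>j. real j * (T / real q ^ m)) [0..<Suc (q ^ m)]"
proof -
  let ?h = "T / real q ^ m"
  let ?l = "map (\<lambda>j. real j * ?h) [0..<Suc (q ^ m)]"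
  have "0 < ?h" using assms by simp
  then have "sorted_wrt (<) ?l"
    unfolding sorted_wrt_map by (intro sorted_wrt_mono_rel[OF _ sorted_wrt_upt] mult_strict_right_mono) auto
  then have "sorted_list_of_set (set ?l) = ?l"
    by (metis finite_set sorted_list_of_set.sorted_key_list_of_set_unique strict_sorted_iff distinct_card)
  moreover have "set ?l = adic_grid T q m"
    by (auto simp: adic_grid_def less_Suc_eq_le simp del: upt_Suc)
  ultimately show ?thesis by (simp only:)
qed

lemma
  assumes "0 < T" "0 < q"
  shows intervals_adic_grid: "intervals (adic_grid T q m) = q ^ m"
    and pt_adic_grid: "j \<le> q ^ m \<Longrightarrow> pt (adic_grid T q m) j = real j * (T / real q ^ m)"
    and is_partition_adic_grid: "is_partition T (adic_grid T q m)"
    and mesh_adic_grid: "mesh (adic_grid T q m) = T / real q ^ m"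
proof -
  let ?h = "T / real q ^ m"
  note sorted = sorted_list_of_adic_grid[OF assms, of m]
  show int: "intervals (adic_grid T q m) = q ^ m"
    using arg_cong[OF sorted, of length] by (simp add: intervals_def)
  show pt: "pt (adic_grid T q m) j = real j * ?h" if "j \<le> q ^ m" for j
    using that by (simp add: pt_def sorted nth_map del: upt_Suc)
  have "adic_grid T q m = (\<lambda>j. real j * ?h) ` {..q ^ m}" by (auto simp: adic_grid_def)
  moreover have "real j * ?h \<le> T" if "j \<le> q ^ m" for j
  proof -
    have "real j \<le> real q ^ m" using that by (metis of_nat_le_iff of_nat_power)
    then have "real j * ?h \<le> real q ^ m * ?h" using assms by (intro mult_right_mono) auto
    then show ?thesis using assms by simp
  qed
  ultimately show "is_partition T (adic_grid T q m)"
    using assms adic_grid_eq_adic_subgrid[OF assms, of m]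
    unfolding is_partition_def by (auto simp: adic_subgrid_def)
  have "(\<lambda>i. pt (adic_grid T q m) (i + 1) - pt (adic_grid T q m) i) ` {..<q ^ m} = (\<lambda>i. ?h) ` {..<q ^ m}"
    using pt by (intro image_cong) (auto simp: algebra_simps simp flip: add_divide_distrib)
  also have "\<dots> = {?h}" using assms by (simp add: image_constant_conv lessThan_empty_iff)
  finally show "mesh (adic_grid T q m) = ?h" by (simp add: mesh_def int)
qed

text \<open>Uniform continuity with tolerance \<open>e powr (1 / p)\<close>, whose p-th power is
  \<open>e\<close>.\<close>

lemma powr_increment_uniformly_small:
  fixes x :: "real \<Rightarrow> real"
  assumes "continuous_on {0..T} x" "0 < p" "0 < e"
  obtains d where "d > 0" "\<And>s s'. s \<in> {0..T} \<Longrightarrow> s' \<in> {0..T} \<Longrightarrow> \<bar>s - s'\<bar> < d \<Longrightarrow> \<bar>x s - x s'\<bar> powr p \<le> e"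
proof -
  have "uniformly_continuous_on {0..T} x" using assms by (simp add: compact_uniformly_continuous)
  moreover have "e powr (1 / p) > 0" using assms by simp
  ultimately obtain d where d: "d > 0"
    "\<And>s s'. s \<in> {0..T} \<Longrightarrow> s' \<in> {0..T} \<Longrightarrow> \<bar>s - s'\<bar> < d \<Longrightarrow> \<bar>x s - x s'\<bar> < e powr (1 / p)"
    unfolding uniformly_continuous_on_def dist_real_def by metis
  have "\<bar>x s - x s'\<bar> powr p \<le> e" if "s \<in> {0..T}" "s' \<in> {0..T}" "\<bar>s - s'\<bar> < d" for s s'
  proof -
    have "\<bar>x s - x s'\<bar> powr p \<le> (e powr (1 / p)) powr p"
      using d(2)[OF that] assms by (intro powr_mono2) auto
    then show ?thesis using assms by (simp add: powr_powr)
  qed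
  with d(1) show ?thesis by (rule that)
qed

text \<open>Only the grid interval containing \<open>t\<close> contributes differently to the two sides.\<close>

lemma tendsto_interval_mass_minus_penergy:
  assumes T: "0 < T" and p: "0 < p" and q: "2 \<le> q" and x: "continuous_on {0..T} x" and t: "t \<in> {0..T}"
  shows "(\<lambda>m. interval_mass (energy_measure T p x (adic_grid T q m)) t - penergy p x (adic_grid T q m) t) \<longlonglongrightarrow> 0"
proof (rule LIMSEQ_I)
  fix e :: real assume "0 < e"
  then have e: "0 < e / 2" by simp
  obtain d where d: "d > 0"
    "\<And>s s'. s \<in> {0..T} \<Longrightarrow> s' \<in> {0..T} \<Longrightarrow> \<bar>s - s'\<bar> < d \<Longrightarrow> \<bar>x s - x s'\<bar> powr p \<le> e / 2"
    using powr_increment_uniformly_small[OF x p e] by blast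
  have "\<forall>\<^sub>F m in sequentially. T / real q ^ m < d"
    using tendsto_adic_width[OF q] d by (intro order_tendstoD(2)) auto
  then obtain m0 where m0: "\<And>m. m \<ge> m0 \<Longrightarrow> T / real q ^ m < d" by (auto simp: eventually_sequentially)
  have "\<bar>interval_mass (energy_measure T p x (adic_grid T q m)) t - penergy p x (adic_grid T q m) t\<bar> < e"
    if m: "m \<ge> m0" for m
  proof -
    \<comment> \<open>\<open>J\<close> is the index of the grid interval containing
      \<open>t\<close>. For t = T it equals \<open>N\<close>, outside the range of summation, and
      the two sums then agree term by term.\<close>
    define h N J where "h = T / real q ^ m" and "N = q ^ m" and "J = nat \<lfloor>t / h\<rfloor>"
    have h: "0 < h" "h < d" "T = real N * h" using T q m0[OF m] by (auto simp: h_def N_def)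
    have J: "real J * h \<le> t" "t < real (J + 1) * h"
    proof -
      have "0 \<le> t / h" using t h by simp
      then have "real J \<le> t / h" "t / h < real (J + 1)" unfolding J_def by linarith+
      then show "real J * h \<le> t" "t < real (J + 1) * h"
        using h(1) by (simp_all add: pos_le_divide_eq pos_divide_less_eq)
    qed
    \<comment> \<open>The terms \<open>c j\<close> of the measure and \<open>v j\<close> of the
      stopped energy agree for j < J (both full) and for j > J (both 0). At J both lie between 0 and
      e / 2.\<close>
    define c where "c j = (if real j * h \<le> t then \<bar>x (real (j + 1) * h) - x (real j * h)\<bar> powr p else 0)" for j
    define v where "v j = \<bar>x (min (real (j + 1) * h) t) - x (min (real j * h) t)\<bar> powr p" for j
    note grid = intervals_adic_grid[OF T, of q m, folded N_def] pt_adic_grid[OF T, of q _ m, folded N_def h_def]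
    have "interval_mass (energy_measure T p x (adic_grid T q m)) t = (\<Sum>i | i < N \<and> real i * h \<le> t. c i)"
    proof -
      have part: "is_partition T (adic_grid T q m)" using T q by (simp add: is_partition_adic_grid)
      show ?thesis
        unfolding interval_mass_energy_measure[OF part]
        using q grid by (intro sum.cong) (auto simp: c_def)
    qed
    also have "\<dots> = (\<Sum>i<N. c i)"
      by (intro sum.mono_neutral_left) (auto simp: c_def)
    finally have C: "interval_mass (energy_measure T p x (adic_grid T q m)) t = (\<Sum>i<N. c i)" .
    have V: "penergy p x (adic_grid T q m) t = (\<Sum>i<N. v i)"
      using q grid by (auto simp: penergy_def v_def intro!: sum.cong)
    have close: "\<bar>c j - v j\<bar> \<le> (if j = J then e / 2 else 0)" if j: "j < N" for j
    proof -
      have in_T: "real i * h \<in> {0..T}" if "i \<le> N" for i using that h by auto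
      have width: "real (j + 1) * h - real j * h = h" by (simp add: algebra_simps)
      consider "j < J" | "j = J" | "J < j" by linarith
      then show ?thesis
      proof cases
        case 1
        then have "real (j + 1) * h \<le> real J * h" using h by (intro mult_right_mono) auto
        then have "real (j + 1) * h \<le> t" "real j * h \<le> t" using J h width by linarith+
        then show ?thesis using e 1 by (simp add: c_def v_def)
      next
        case 2
        have "\<bar>x (real (j + 1) * h) - x (real j * h)\<bar> powr p \<le> e / 2"
          using in_T[of "j + 1"] in_T[of j] j width h by (intro d(2)) auto
        then have "c j \<le> e / 2" using e by (simp add: c_def)
        moreover have "v j \<le> e / 2"
          unfolding v_def using in_T[of "j + 1"] in_T[of j] j width h t J 2 by (intro d(2)) auto
        moreover have "0 \<le> c j" "0 \<le> v j" by (auto simp: c_def v_def)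
        ultimately have "\<bar>c j - v j\<bar> \<le> e / 2" by linarith
        then show ?thesis using 2 by simp
      next
        case 3
        then have "real (J + 1) * h \<le> real j * h" using h by (intro mult_right_mono) auto
        then have "t < real j * h" "t < real (j + 1) * h" using J h width by linarith+
        then show ?thesis using e 3 by (simp add: c_def v_def)
      qed
    qed
    have "\<bar>(\<Sum>i<N. c i) - (\<Sum>i<N. v i)\<bar> \<le> (\<Sum>i<N. \<bar>c i - v i\<bar>)"
      unfolding sum_subtractf[symmetric] by (rule sum_abs)
    also have "\<dots> \<le> (\<Sum>i<N. if i = J then e / 2 else 0)" using close by (intro sum_mono) auto
    also have "\<dots> \<le> e / 2" using e by (simp add: sum.delta)
    also have "\<dots> < e" using e by simp
    finally show ?thesis by (simp only: C V)
  qed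
  then show "\<exists>m0. \<forall>m\<ge>m0. norm (interval_mass (energy_measure T p x (adic_grid T q m)) t -
      penergy p x (adic_grid T q m) t - 0) < e"
    unfolding diff_0_right real_norm_def by blast
qed

section \<open>Variation along adic grids versus pointwise limits of stopped energies\<close>

lemma finite_measure_on_Icc_with_interval_mass:
  assumes T: "0 < T" and A: "continuous_on {0..T} A" "mono_on {0..T} A" "A 0 = 0"
  obtains M where "finite_measure_on_Icc M T" "\<And>s. measure M {s} = 0"
    "\<And>t. t \<in> {0..T} \<Longrightarrow> interval_mass M t = A t"
proof -
  \<comment> \<open>Since \<open>A\<close> is controlled only on [0,T], it is extended by its
    endpoint values to a continuous nondecreasing function on the line. The Lebesgue-Stieltjes
    measure of \<open>F\<close> then charges no point.\<close>
  define F where "F s = A (max 0 (min T s))" for s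
  have mono: "F s \<le> F t" if "s \<le> t" for s t
    unfolding F_def using T that by (intro mono_onD[OF A(2)]) auto
  have cont: "continuous_on UNIV F"
    unfolding F_def using T by (intro continuous_on_compose2[OF A(1)] continuous_intros) auto
  have Icc: "emeasure (interval_measure F) {a..b} = F b - F a" if "a \<le> b" for a b
    by (rule emeasure_interval_measure_Icc[OF that mono cont])
  let ?M = "restrict_space (interval_measure F) {0..T}"
  have em: "emeasure ?M B = emeasure (interval_measure F) B" if "B \<subseteq> {0..T}" for B
    using that by (simp add: emeasure_restrict_space)
  have "finite_measure ?M"
    using T Icc[of 0 T] by (intro finite_measureI) (simp add: space_restrict_space em)
  moreover have "sets ?M = sets (restrict_space borel {0..T})"
    by (intro sets_restrict_space_cong) simp
  ultimately have M: "finite_measure_on_Icc ?M T"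
    by (simp add: finite_measure_on_Icc_def finite_measure_on_Icc_axioms_def)
  interpret finite_measure_on_Icc ?M T by (rule M)
  have "measure ?M {s} = 0" for s
  proof (cases "s \<in> {0..T}")
    case True
    then show ?thesis using Icc[of s s] em[of "{s}"] by (simp add: measure_def)
  next
    case False
    then show ?thesis using sets.sets_into_space by (metis measure_notin_sets insert_subset space_eq)
  qed
  moreover have "interval_mass ?M t = A t" if t: "t \<in> {0..T}" for t
  proof -
    have "A 0 \<le> A t" using t T by (intro mono_onD[OF A(2)]) auto
    moreover have "emeasure ?M {0..t} = F t - F 0" using t by (simp add: em Icc)
    ultimately show ?thesis
      using t T A(3) by (simp add: interval_mass_eq_measure measure_def F_def)
  qed
  ultimately show ?thesis using M by (intro that)
qed

text \<open>Without point masses the limiting distribution function is continuous, so weak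
  convergence gives convergence of the interval masses at every \<open>t\<close>. These differ from
  the stopped energies by a null sequence.\<close>

lemma variation_measure_of_adic_grid:
  assumes T: "0 < T" and p: "0 < p" and q: "2 \<le> q" and x: "continuous_on {0..T} x"
    and \<mu>: "variation_measure_of T p (adic_grid T q) x \<mu>"
  shows "finite_measure_on_Icc \<mu> T" and "\<And>s. measure \<mu> {s} = 0"
    and "t \<in> {0..T} \<Longrightarrow> (\<lambda>m. penergy p x (adic_grid T q m) t) \<longlonglongrightarrow> measure \<mu> {0..t}"
proof -
  let ?E = "\<lambda>m. energy_measure T p x (adic_grid T q m)"
  show M: "finite_measure_on_Icc \<mu> T"
    using \<mu> by (simp add: variation_measure_of_def finite_measure_on_Icc_def finite_measure_on_Icc_axioms_def)
  interpret finite_measure_on_Icc \<mu> T by (rule M)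
  have part: "is_partition T (adic_grid T q m)" for m using T q by (simp add: is_partition_adic_grid)
  show null: "measure \<mu> {s} = 0" for s
    using \<mu> by (intro nonatomic_imp_singleton_null) (simp add: variation_measure_of_def)
  assume t: "t \<in> {0..T}"
  have "(\<lambda>m. interval_mass (?E m) t) \<longlonglongrightarrow> interval_mass \<mu> t"
    using \<mu> by (intro tendsto_interval_mass_if_converges_weakly_on[OF M] isCont_interval_mass null
        finite_measure_on_Icc_energy_measure part) (simp add: variation_measure_of_def)
  from tendsto_diff[OF this tendsto_interval_mass_minus_penergy[OF T p q x t]]
  show "(\<lambda>m. penergy p x (adic_grid T q m) t) \<longlonglongrightarrow> measure \<mu> {0..t}"
    using t by (simp add: interval_mass_eq_measure)
qed

lemma has_variation_along_adic_grid:
  assumes T: "0 < T" and p: "0 < p" and q: "2 \<le> q" and x: "continuous_on {0..T} x"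
    and A: "continuous_on {0..T} A" "mono_on {0..T} A" "A 0 = 0"
    and lim: "\<And>t. t \<in> {0..T} \<Longrightarrow> (\<lambda>m. penergy p x (adic_grid T q m) t) \<longlonglongrightarrow> A t"
  shows "has_variation_along T p (adic_grid T q) x"
proof -
  let ?E = "\<lambda>m. energy_measure T p x (adic_grid T q m)"
  obtain M where M: "finite_measure_on_Icc M T" "\<And>s. measure M {s} = 0"
    "\<And>t. t \<in> {0..T} \<Longrightarrow> interval_mass M t = A t"
    using finite_measure_on_Icc_with_interval_mass[OF T A] by blast
  interpret finite_measure_on_Icc M T by (rule M)
  have part: "is_partition T (adic_grid T q m)" for m using T q by (simp add: is_partition_adic_grid)
  have "(\<lambda>m. interval_mass (?E m) t) \<longlonglongrightarrow> interval_mass M t" if t: "t \<in> {0..T}" for t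
    using tendsto_add[OF tendsto_interval_mass_minus_penergy[OF T p q x t] lim[OF t]] M(3)[OF t] by simp
  then have "converges_weakly_on T ?E M"
    by (intro converges_weakly_on_if_interval_mass[OF T M(1)] finite_measure_on_Icc_energy_measure part)
  then have "variation_measure_of T p (adic_grid T q) x M"
    unfolding variation_measure_of_def
    by (intro conjI sets_eq finite_measure_axioms singletons_null_imp_nonatomic M(2))
  moreover have "mesh (adic_grid T q m) = T / real q ^ m" for m using T q by (simp add: mesh_adic_grid)
  ultimately show ?thesis
    unfolding has_variation_along_def using part tendsto_adic_width[OF q, of T] by (simp, blast)
qed

text \<open>The properties are read off from the distribution function of the measure chosen by
  \<open>SOME\<close>. The last one determines \<open>A\<close> on [0,T] as a limit of
  energies.\<close>

lemma variation_along_adic_grid: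
  assumes T: "0 < T" and p: "0 < p" and q: "2 \<le> q" and x: "continuous_on {0..T} x"
    and var: "has_variation_along T p (adic_grid T q) x"
  defines "A \<equiv> variation_along T p (adic_grid T q) x"
  shows "continuous_on {0..T} A" "mono_on {0..T} A" "A 0 = 0"
    and "t \<in> {0..T} \<Longrightarrow> (\<lambda>m. penergy p x (adic_grid T q m) t) \<longlonglongrightarrow> A t"
proof -
  define \<mu> where "\<mu> = variation_measure T p (adic_grid T q) x"
  have "variation_measure_of T p (adic_grid T q) x \<mu>"
    using var unfolding \<mu>_def variation_measure_def has_variation_along_def by (blast intro: someI_ex)
  note \<mu> = variation_measure_of_adic_grid[OF T p q x this]
  interpret finite_measure_on_Icc \<mu> T by (rule \<mu>)
  have A: "A t = measure \<mu> {0..t}" for t by (simp add: A_def variation_along_def \<mu>_def)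
  have eq: "A t = interval_mass \<mu> t" if "t \<in> {0..T}" for t
    using that by (simp add: A interval_mass_eq_measure)
  show "mono_on {0..T} A"
    by (intro mono_onI) (simp add: eq monoD[OF mono_interval_mass])
  have "continuous_on {0..T} (interval_mass \<mu>)"
    using isCont_interval_mass[OF \<mu>(2)] by (simp add: continuous_at_imp_continuous_on)
  then show "continuous_on {0..T} A" by (rule continuous_on_eq) (simp add: eq)
  show "A 0 = 0" using \<mu>(2)[of 0] by (simp add: A)
  show "t \<in> {0..T} \<Longrightarrow> (\<lambda>m. penergy p x (adic_grid T q m) t) \<longlonglongrightarrow> A t"
    unfolding A by (rule \<mu>(3))
qed

section \<open>Equivalence of roughness and the adic criterion\<close>

lemma intrinsic_variation_of_imp_adic_criterion:
  assumes T: "0 < T" and p: "0 < p" and q: "2 \<le> q" and x: "continuous_on {0..T} x"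
    and A: "intrinsic_variation_of T p x A"
  shows "adic_criterion T q p x"
    and "\<And>t. t \<in> {0..T} \<Longrightarrow> A t = variation_along T p (adic_grid T q) x t"
proof -
  have lim: "(\<lambda>m. penergy p x (adic_grid T q m) t) \<longlonglongrightarrow> A t" if "t \<in> {0..T}" for t
    using A that by (intro tendsto_penergy_adic_grid[OF T q]) (auto simp: intrinsic_variation_of_def)
  have var: "has_variation_along T p (adic_grid T q) x"
    using A by (intro has_variation_along_adic_grid[OF T p q x _ _ _ lim]) (auto simp: intrinsic_variation_of_def)
  \<comment> \<open>Both sides are limits of the same stopped energies along the adic grids.\<close>
  show eq: "A t = variation_along T p (adic_grid T q) x t" if "t \<in> {0..T}" for t
    using LIMSEQ_unique[OF lim[OF that] variation_along_adic_grid(4)[OF T p q x var that]] .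
  have "A T > 0" using A by (simp add: intrinsic_variation_of_def)
  then have pos: "variation_along T p (adic_grid T q) x T > 0" using eq[of T] T by simp
  have "filterlim (\<lambda>L. T / real L) (at_right 0) sequentially"
  proof (rule tendsto_imp_filterlim_at_right[OF lim_const_over_n])
    show "\<forall>\<^sub>F L in sequentially. 0 < T / real L"
      using T by (intro eventually_sequentiallyI[of 1]) simp
  qed
  moreover have "(Omega T p A x \<longlongrightarrow> 0) (at_right 0)" using A by (simp add: intrinsic_variation_of_def)
  ultimately have "(\<lambda>L. Omega T p A x (T / real L)) \<longlonglongrightarrow> 0" by (rule filterlim_compose[rotated])
  from tendsto_add[OF this this]
  have \<Omega>: "(\<lambda>L. 2 * Omega T p A x (T / real L)) \<longlonglongrightarrow> 0" by (simp add: mult_2)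
  have "(\<lambda>L. defect_limsup T q p L x) \<longlonglongrightarrow> 0"
  proof (rule tendsto_sandwich[OF _ _ tendsto_const \<Omega>])
    show "\<forall>\<^sub>F L in sequentially. defect_limsup T q p L x \<le> 2 * Omega T p A x (T / real L)"
      by (rule eventually_sequentiallyI[of 1]) (rule defect_limsup_le_Omega[OF T q])
  qed simp
  with var pos show "adic_criterion T q p x" by (simp add: adic_criterion_def)
qed

lemma adic_criterion_imp_intrinsic_variation_of:
  assumes T: "0 < T" and p: "0 < p" and q: "2 \<le> q" and x: "continuous_on {0..T} x"
    and crit: "adic_criterion T q p x"
  shows "intrinsic_variation_of T p x (variation_along T p (adic_grid T q) x)"
proof -
  let ?A = "variation_along T p (adic_grid T q) x"
  have var: "has_variation_along T p (adic_grid T q) x" and pos: "?A T > 0"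
    and R: "(\<lambda>L. defect_limsup T q p L x) \<longlonglongrightarrow> 0"
    using crit by (auto simp: adic_criterion_def)
  note A = variation_along_adic_grid[OF T p q x var]
  have "(Omega T p ?A x \<longlongrightarrow> 0) (at_right 0)"
  proof (rule order_tendstoI)
    fix e :: ennreal assume "0 < e"
    then have "\<forall>\<^sub>F L in sequentially. defect_limsup T q p L x < e \<and> 1 \<le> L"
      by (intro eventually_conj order_tendstoD(2)[OF R] eventually_ge_at_top)
    then obtain L where L: "defect_limsup T q p L x < e" "1 \<le> L"
      by (auto simp: eventually_sequentially)
    \<comment> \<open>A single good \<open>L\<close> suffices, since \<open>Omega\<close> is
      monotone in the width and the bound passes to all smaller widths.\<close>
    have "Omega T p ?A x (T / real L) < e"
      using Omega_le_defect_limsup[OF T p q x L(2) A(4)] L(1) by (rule le_less_trans)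
    then have "Omega T p ?A x \<delta> < e" if "\<delta> < T / real L" for \<delta>
      by (rule le_less_trans[OF Omega_mono[OF less_imp_le[OF that]]])
    then show "\<forall>\<^sub>F \<delta> in at_right 0. Omega T p ?A x \<delta> < e"
      using T L(2) by (auto simp: eventually_at_right_field intro!: exI[of _ "T / real L"])
  qed auto
  then show ?thesis using A pos by (simp add: intrinsic_variation_of_def)
qed

theorem proposition3p4:
  fixes p T :: real and x :: "real \<Rightarrow> real"
  assumes "p > 1" and "T > 0" and "continuous_on {0..T} x"
  shows "(p_rough T p x \<longleftrightarrow> adic_criterion T 2 p x) \<and>
    (p_rough T p x \<longrightarrow>
      (\<forall>t\<in>{0..T}. intrinsic_variation T p x t = variation_along T p (adic_grid T 2) x t) \<and>
      (\<exists>l. (Omega T p (variation_along T p (adic_grid T 2) x) x \<longlongrightarrow> l) (at_right 0) \<and>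
        (\<forall>L\<ge>2. l \<le> defect_limsup T 2 p L x \<and>
          defect_limsup T 2 p L x \<le> 2 * Omega T p (intrinsic_variation T p x) x (T / real L)))) \<and>
    (\<forall>q\<ge>2. p_rough T p x \<longleftrightarrow> adic_criterion T q p x)"
proof -
  have p: "0 < p" using assms by simp
  have iff: "p_rough T p x \<longleftrightarrow> adic_criterion T q p x" if "2 \<le> q" for q
    using intrinsic_variation_of_imp_adic_criterion(1)[OF assms(2) p that assms(3)]
      adic_criterion_imp_intrinsic_variation_of[OF assms(2) p that assms(3)]
    unfolding p_rough_def by blast
  have "(\<forall>t\<in>{0..T}. intrinsic_variation T p x t = variation_along T p (adic_grid T 2) x t) \<and>
      (Omega T p (variation_along T p (adic_grid T 2) x) x \<longlongrightarrow> 0) (at_right 0)"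
    if rough: "p_rough T p x"
  proof -
    have "intrinsic_variation_of T p x (intrinsic_variation T p x)"
      using rough unfolding p_rough_def intrinsic_variation_def by (rule someI_ex)
    \<comment> \<open>The dyadic criterion makes the dyadic variation an admissible
      \<open>A\<close>, so its own \<open>Omega\<close> tends to 0. Agreement with the chosen
      \<open>intrinsic_variation\<close> comes from the identification on [0,T].\<close>
    moreover have "intrinsic_variation_of T p x (variation_along T p (adic_grid T 2) x)"
      using rough iff assms p by (intro adic_criterion_imp_intrinsic_variation_of) auto
    ultimately show ?thesis
      using intrinsic_variation_of_imp_adic_criterion(2)[OF assms(2) p order_refl assms(3)]
      by (simp add: intrinsic_variation_of_def)
  qed
  moreover have "defect_limsup T 2 p L x \<le> 2 * Omega T p (intrinsic_variation T p x) x (T / real L)"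
    if "2 \<le> L" for L
    using that assms(2) by (intro defect_limsup_le_Omega) auto
  \<comment> \<open>The limit of \<open>Omega\<close> is 0, so 0 is the witness for \<open>l\<close>
    and the lower inequality is nonnegativity.\<close>
  ultimately show ?thesis using iff by (intro conjI impI allI exI[of _ 0] zero_le) auto
qed

end
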